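(* Let $\Omega=(-B,B)^d$ with $B>0$, let $\mathbb{P}$ be the Lebesgue measure on $\Omega$, let $L>0$, $m\in\mathbb{N}$, $M=m^d$, $\eta\ge0$, let $k$ be a shift-invariant positive definite kernel with spectral density $S$, and let $\mathbf{x}_1,\dots,\mathbf{x}_N\in\Omega$ be distinct. Let $\phi_{\mathbf{j}}(\mathbf{x})=L^{-d/2}\prod_{r=1}^d\sin\left(\frac{\pi j_r}{2L}(x_r+L)\right)$ be the sine basis. Index the truncated basis $\{\phi_{\mathbf{j}}\}_{\mathbf{j}\in[m]^d}$ in any fixed order so that $\phi(\mathbf{x}):=[\phi_1(\mathbf{x}),\ldots,\phi_M(\mathbf{x})]^{T}$, and let $\Phi=[\phi_i(\mathbf{x}_n)]\in\mathbb{R}^{N\times M}$, $i\in\{1,\ldots,M\}$, $n\in\{1,\ldots,N\}$, be the design matrix, whose $(n,i)$ entry is $\phi_i(\mathbf{x}_n)$. Define the spectral matrix (indexed in the same order as $\phi$) and the Gram matrix $$\mathbf{W}:=\mathrm{diag}\left[S\left(\frac{\pi\mathbf{j}}{2L}\right)\right]_{\mathbf{j}\in[m]^d},\qquad \mathbf{G}_d:=\int_\Omega\phi(\mathbf{x})\phi^{T}(\mathbf{x})\,d\mathbb{P}(\mathbf{x}),$$ and let $$\mathbf{h}(\mathbf{t})=\phi(\mathbf{t})-\Phi^{T}(\mathbf{K}_N+\eta\mathbf{I}_N)^{-1}\mathbf{k}_N(\mathbf{t}).$$ Then, for $\mathbf{t}\in\Omega$ with $P_{N,\eta}^2(\mathbf{t})+\eta>0$,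 $\widehat{\mathrm{IMSE}}_m(\mathbf{t})$ admits the closed form $$\widehat{\mathrm{IMSE}}_m(\mathbf{t})=\frac{\mathbf{h}^{T}(\mathbf{t})\,\mathbf{W}\,\mathbf{G}_d\,\mathbf{W}\,\mathbf{h}(\mathbf{t})}{P_{N,\eta}^2(\mathbf{t})+\eta}=\frac{\mathbf{h}^{T}(\mathbf{t})\,\mathbf{W}\left[\mathbf{G}_1^{\otimes d}\right]\mathbf{W}\,\mathbf{h}(\mathbf{t})}{P_{N,\eta}^2(\mathbf{t})+\eta},$$ where $\mathbf{G}_1^{\otimes d}$ is the $d$-fold Kronecker power of the $m\times m$ matrix $\mathbf{G}_1$ with entries, for $p,q\in\{1,\dots,m\}$ and one-dimensional basis functions $\phi_p(x)=L^{-1/2}\sin\left(\frac{\pi p}{2L}(x+L)\right)$, $$[\mathbf{G}_1]_{p,q}=\int_{-B}^{B}\phi_p(x)\phi_q(x)\,dx=\begin{cases}\dfrac{B}{L}-\dfrac{1}{2\pi p}\left[\sin\left(\dfrac{\pi p}{L}(L+B)\right)-\sin\left(\dfrac{\pi p}{L}(L-B)\right)\right], & p=q,\\[2mm] \dfrac1\pi\left[\dfrac{1}{p-q}\sin\left(\dfrac{\pi}{2L}(p-q)s\right)-\dfrac{1}{p+q}\sin\left(\dfrac{\pi}{2L}(p+q)s\right)\right]\Big|_{s=L-B}^{s=L+B}, & p\ne q.\end{cases}$$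
   Context: Notation: $[m]^d=\{1,\ldots,m\}^d$. $\mathbf{k}_N(\mathbf{x}):=[k(\mathbf{x},\mathbf{x}_1),\ldots,k(\mathbf{x},\mathbf{x}_N)]^{T}$, $\mathbf{K}_N:=(k(\mathbf{x}_i,\mathbf{x}_j))_{1\le i,j\le N}$, $\mathbf{I}_N$ is the $N\times N$ identity, and the power function is $P_{N,\eta}(\mathbf{t})=\left[k(\mathbf{t},\mathbf{t})-\mathbf{k}_N^{T}(\mathbf{t})(\mathbf{K}_N+\eta\mathbf{I}_N)^{-1}\mathbf{k}_N(\mathbf{t})\right]^{1/2}$. Shift-invariant means $k(\mathbf{x},\mathbf{x}')=k(\mathbf{x}-\mathbf{x}')$, and the spectral density is $S(\omega)=\int_{\mathbb{R}^d}k(\mathbf{h})\exp(-i\omega^{T}\mathbf{h})\,d\mathbf{h}$. The truncated Hilbert space Gaussian process (HSGP) kernel approximation is $$\hat k_m(\mathbf{x},\mathbf{x}'):=\sum_{\mathbf{j}\in[m]^d}S\left(\frac{\pi\mathbf{j}}{2L}\right)\phi_{\mathbf{j}}(\mathbf{x})\phi_{\mathbf{j}}(\mathbf{x}'),$$ and $\hat{\mathbf{k}}_{N,m}(\mathbf{x}):=[\hat k_m(\mathbf{x},\mathbf{x}_1),\ldots,\hat k_m(\mathbf{x},\mathbf{x}_N)]^{T}$. The HSGP approximation of the integrated mean squared error (IMSE) acquisition function is $$\widehat{\mathrm{IMSE}}_m(\mathbf{t}):=\frac{1}{P_{N,\eta}^2(\mathbf{t})+\eta}\int_\Omega\left[\hat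 k_m(\mathbf{x},\mathbf{t})-\hat{\mathbf{k}}_{N,m}^{T}(\mathbf{x})(\mathbf{K}_N+\eta\mathbf{I}_N)^{-1}\mathbf{k}_N(\mathbf{t})\right]^2d\mathbb{P}(\mathbf{x}).$$
   Formalization: For a basis order other than the lexicographic one, the Kronecker power in the second equality is taken with its rows and columns rearranged into that order (the literal Kronecker power would make the equality false); for lexicographic order it is the literal Kronecker power. *)

theory Defs
  imports "HOL-Analysis.Analysis" "Jordan_Normal_Form.Gauss_Jordan_Elimination"
    "Jordan_Normal_Form.Determinant"
begin

text \<open>
  Points of the input space are elements of \<^typ>\<open>real ^ 'd\<close>, so that the dimension is
  \<open>CARD('d)\<close>. Matrices and vectors of size \<open>N\<close>, \<open>m\<close>, \<open>m ^ d\<close> are those of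
  \<^theory>\<open>Jordan_Normal_Form.Matrix\<close>, with indices starting at \<open>0\<close>. The symbols shared by
  both libraries are resolved in favour of \<^theory>\<open>Jordan_Normal_Form.Matrix\<close>, and the
  components of a point are written with \<open>$h\<close>.
\<close>

hide_const (open) Finite_Cartesian_Product.vec Finite_Cartesian_Product.mat
  Finite_Cartesian_Product.row Finite_Cartesian_Product.rows
  Determinants.det
hide_type (open) Finite_Cartesian_Product.vec
no_notation vec_nth (infixl "$" 90)
notation vec_nth (infixl "$h" 90)
no_notation inner (infix "\<bullet>" 70)


section \<open>Matrices\<close>

text \<open>The inverse as a total function; a singular matrix is sent to the zero matrix.\<close>

definition mat_inv :: "real mat \<Rightarrow> real mat" where
  "mat_inv A = (case mat_inverse A of Some B \<Rightarrow> B | None \<Rightarrow> 0\<^sub>m (dim_row A) (dim_row A))"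

text \<open>The first factor is the outer (most significant) block index.\<close>

definition kronecker :: "real mat \<Rightarrow> real mat \<Rightarrow> real mat" where
  "kronecker A B = mat (dim_row A * dim_row B) (dim_col A * dim_col B)
     (\<lambda>(i, j). A $$ (i div dim_row B, j div dim_col B) * B $$ (i mod dim_row B, j mod dim_col B))"

fun kronecker_power :: "real mat \<Rightarrow> nat \<Rightarrow> real mat" where
  "kronecker_power A 0 = 1\<^sub>m 1"
| "kronecker_power A (Suc n) = kronecker A (kronecker_power A n)"


section \<open>Kernels\<close>

definition positive_definite_kernel :: "('a \<Rightarrow> 'a \<Rightarrow> real) \<Rightarrow> bool" where
  "positive_definite_kernel k \<longleftrightarrow>
     (\<forall>x y. k x y = k y x) \<and>
     (\<forall>(n::nat) (x :: nat \<Rightarrow> 'a) (c :: nat \<Rightarrow> real). 0 \<le> (\<Sum>i<n. \<Sum>j<n. c i * c j * k (x i) (x j)))"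

text \<open>\<open>\<kappa>\<close> is the function of one argument with \<open>k x x' = \<kappa> (x - x')\<close>.\<close>

definition shift_invariant_kernel ::
    "('a::ab_group_add \<Rightarrow> 'a \<Rightarrow> real) \<Rightarrow> ('a \<Rightarrow> real) \<Rightarrow> bool" where
  "shift_invariant_kernel k \<kappa> \<longleftrightarrow> (\<forall>x x'. k x x' = \<kappa> (x - x'))"

text \<open>The Fourier integral exists and has the real value \<open>S \<omega>\<close> (\<open>\<kappa>\<close> is even for a symmetric
  kernel, so the Fourier transform is real).\<close>

definition has_spectral_density :: "(real ^ 'd \<Rightarrow> real) \<Rightarrow> (real ^ 'd \<Rightarrow> real) \<Rightarrow> bool" where
  "has_spectral_density \<kappa> S \<longleftrightarrow>
     (\<forall>\<omega>. has_bochner_integral lebesgue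
        (\<lambda>h. complex_of_real (\<kappa> h) * exp (- (\<i> * complex_of_real (inner \<omega> h))))
        (complex_of_real (S \<omega>)))"

text \<open>The list \<open>xs\<close> holds the design points \<open>x_1, ..., x_N\<close>.\<close>

definition k_vec :: "('a \<Rightarrow> 'a \<Rightarrow> real) \<Rightarrow> 'a list \<Rightarrow> 'a \<Rightarrow> real vec" where
  "k_vec k xs x = vec (length xs) (\<lambda>i. k x (xs ! i))"

definition K_mat :: "('a \<Rightarrow> 'a \<Rightarrow> real) \<Rightarrow> 'a list \<Rightarrow> real mat" where
  "K_mat k xs = mat (length xs) (length xs) (\<lambda>(i, j). k (xs ! i) (xs ! j))"

definition reg_K_mat :: "('a \<Rightarrow> 'a \<Rightarrow> real) \<Rightarrow> 'a list \<Rightarrow> real \<Rightarrow> real mat" where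
  "reg_K_mat k xs \<eta> = K_mat k xs + \<eta> \<cdot>\<^sub>m 1\<^sub>m (length xs)"

definition power_function :: "('a \<Rightarrow> 'a \<Rightarrow> real) \<Rightarrow> 'a list \<Rightarrow> real \<Rightarrow> 'a \<Rightarrow> real" where
  "power_function k xs \<eta> t =
     sqrt (k t t - k_vec k xs t \<bullet> (mat_inv (reg_K_mat k xs \<eta>) *\<^sub>v k_vec k xs t))"


section \<open>The Hilbert space approximation\<close>

definition cube :: "real \<Rightarrow> (real ^ 'd) set" where
  "cube B = {x. \<forall>r. - B < x $h r \<and> x $h r < B}"

definition multi_indices :: "nat \<Rightarrow> ('d \<Rightarrow> nat) set" where
  "multi_indices m = {j. \<forall>r. j r \<in> {1..m}}"

definition frequency :: "real \<Rightarrow> ('d \<Rightarrow> nat) \<Rightarrow> real ^ 'd" where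
  "frequency L j = (\<chi> r. pi * real (j r) / (2 * L))"

definition sine_basis :: "real \<Rightarrow> ('d::finite \<Rightarrow> nat) \<Rightarrow> real ^ 'd \<Rightarrow> real" where
  "sine_basis L j x = L powr (- real CARD('d) / 2) *
     (\<Prod>r\<in>UNIV. sin (pi * real (j r) / (2 * L) * (x $h r + L)))"

definition sine_basis_1 :: "real \<Rightarrow> nat \<Rightarrow> real \<Rightarrow> real" where
  "sine_basis_1 L p x = L powr (- 1 / 2) * sin (pi * real p / (2 * L) * (x + L))"

definition hsgp_kernel ::
    "(real ^ 'd \<Rightarrow> real) \<Rightarrow> real \<Rightarrow> nat \<Rightarrow> real ^ 'd \<Rightarrow> real ^ 'd \<Rightarrow> real" where
  "hsgp_kernel S L m x x' =
     (\<Sum>j\<in>multi_indices m. S (frequency L j) * sine_basis L j x * sine_basis L j x')"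

definition hsgp_imse ::
    "(real ^ 'd) measure \<Rightarrow> (real ^ 'd \<Rightarrow> real ^ 'd \<Rightarrow> real) \<Rightarrow> (real ^ 'd \<Rightarrow> real) \<Rightarrow> real \<Rightarrow> nat \<Rightarrow>
     (real ^ 'd) list \<Rightarrow> real \<Rightarrow> real ^ 'd \<Rightarrow> real" where
  "hsgp_imse P k S L m xs \<eta> t =
     1 / ((power_function k xs \<eta> t)\<^sup>2 + \<eta>) *
     (LINT x|P. (hsgp_kernel S L m x t -
        k_vec (hsgp_kernel S L m) xs x \<bullet> (mat_inv (reg_K_mat k xs \<eta>) *\<^sub>v k_vec k xs t))\<^sup>2)"


section \<open>Matrices of the truncated basis\<close>

text \<open>An ordering of the basis is a bijection \<open>e\<close> from \<open>{..<m ^ d}\<close> to the multi-indices.\<close>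

definition basis_vec :: "real \<Rightarrow> nat \<Rightarrow> (nat \<Rightarrow> 'd::finite \<Rightarrow> nat) \<Rightarrow> real ^ 'd \<Rightarrow> real vec" where
  "basis_vec L m e x = vec (m ^ CARD('d)) (\<lambda>a. sine_basis L (e a) x)"

definition design_mat ::
    "real \<Rightarrow> nat \<Rightarrow> (nat \<Rightarrow> 'd::finite \<Rightarrow> nat) \<Rightarrow> (real ^ 'd) list \<Rightarrow> real mat" where
  "design_mat L m e xs =
     mat (length xs) (m ^ CARD('d)) (\<lambda>(n, a). sine_basis L (e a) (xs ! n))"

definition spectral_mat ::
    "(real ^ 'd \<Rightarrow> real) \<Rightarrow> real \<Rightarrow> nat \<Rightarrow> (nat \<Rightarrow> 'd::finite \<Rightarrow> nat) \<Rightarrow> real mat" where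
  "spectral_mat S L m e = mat_diag (m ^ CARD('d)) (\<lambda>a. S (frequency L (e a)))"

definition gram_mat ::
    "(real ^ 'd) measure \<Rightarrow> real \<Rightarrow> nat \<Rightarrow> (nat \<Rightarrow> 'd::finite \<Rightarrow> nat) \<Rightarrow> real mat" where
  "gram_mat P L m e = mat (m ^ CARD('d)) (m ^ CARD('d))
     (\<lambda>(a, b). LINT x|P. sine_basis L (e a) x * sine_basis L (e b) x)"

definition gram_mat_1 :: "real \<Rightarrow> real \<Rightarrow> nat \<Rightarrow> real mat" where
  "gram_mat_1 B L m = mat m m
     (\<lambda>(i, j). LINT x|lebesgue_on {-B..B}. sine_basis_1 L (Suc i) x * sine_basis_1 L (Suc j) x)"

definition h_vec ::
    "(real ^ 'd \<Rightarrow> real ^ 'd \<Rightarrow> real) \<Rightarrow> real \<Rightarrow> nat \<Rightarrow> (nat \<Rightarrow> 'd::finite \<Rightarrow> nat) \<Rightarrow>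
     (real ^ 'd) list \<Rightarrow> real \<Rightarrow> real ^ 'd \<Rightarrow> real vec" where
  "h_vec k L m e xs \<eta> t = basis_vec L m e t -
     (design_mat L m e xs)\<^sup>T *\<^sub>v (mat_inv (reg_K_mat k xs \<eta>) *\<^sub>v k_vec k xs t)"

text \<open>
  The rows and columns of a Kronecker power correspond to the multi-indices in lexicographic
  order. With the coordinates numbered \<open>c 0, c 1, ...\<close>, \<open>lex_position m c j\<close> is the position of
  \<open>j\<close> in this order, and \<open>kronecker_power_ordered\<close> is the Kronecker power with its rows and
  columns rearranged into the order \<open>e\<close>.
\<close>

definition lex_position :: "nat \<Rightarrow> (nat \<Rightarrow> 'd::finite) \<Rightarrow> ('d \<Rightarrow> nat) \<Rightarrow> nat" where
  "lex_position m c j = (\<Sum>r<CARD('d). (j (c r) - 1) * m ^ (CARD('d) - Suc r))"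

definition kronecker_power_ordered ::
    "nat \<Rightarrow> (nat \<Rightarrow> 'd::finite) \<Rightarrow> (nat \<Rightarrow> 'd \<Rightarrow> nat) \<Rightarrow> real mat \<Rightarrow> real mat" where
  "kronecker_power_ordered m c e A = mat (m ^ CARD('d)) (m ^ CARD('d))
     (\<lambda>(a, b). kronecker_power A CARD('d) $$ (lex_position m c (e a), lex_position m c (e b)))"


section \<open>The regularised kernel matrix is invertible\<close>

lemma mat_inv_posdef:
  assumes A: "A \<in> carrier_mat n n"
    and pos: "\<And>v. v \<in> carrier_vec n \<Longrightarrow> v \<noteq> 0\<^sub>v n \<Longrightarrow> 0 < v \<bullet> (A *\<^sub>v v)"
  shows "A * mat_inv A = 1\<^sub>m n" and "mat_inv A * A = 1\<^sub>m n"
proof -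
  have "det A \<noteq> 0"
  proof
    assume "det A = 0"
    then obtain v where "v \<in> carrier_vec n" "v \<noteq> 0\<^sub>v n" "A *\<^sub>v v = 0\<^sub>v n"
      using det_0_iff_vec_prod_zero_field[OF A] by blast
    then show False using pos[of v] by simp
  qed
  then have "A \<in> Units (ring_mat TYPE(real) n ())"
    by (rule det_non_zero_imp_unit[OF A])
  then obtain C where "mat_inverse A = Some C"
    using mat_inverse(1)[OF A, where b = "()"] by (cases "mat_inverse A") auto
  then show "A * mat_inv A = 1\<^sub>m n" "mat_inv A * A = 1\<^sub>m n"
    using mat_inverse(2)[OF A] by (auto simp: mat_inv_def)
qed

lemma reg_K_mat_carrier: "reg_K_mat k xs \<eta> \<in> carrier_mat (length xs) (length xs)"
  by (simp add: reg_K_mat_def K_mat_def)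

lemma reg_K_mat_form:
  assumes "v \<in> carrier_vec (length xs)"
  shows "v \<bullet> (reg_K_mat k xs \<eta> *\<^sub>v v) =
    (\<Sum>i<length xs. \<Sum>j<length xs. v $ i * v $ j * k (xs ! i) (xs ! j)) + \<eta> * (\<Sum>i<length xs. (v $ i)\<^sup>2)"
proof -
  have "v \<bullet> (reg_K_mat k xs \<eta> *\<^sub>v v) = (\<Sum>i<length xs. v $ i *
      (\<Sum>j<length xs. (k (xs ! i) (xs ! j) + (if i = j then \<eta> else 0)) * v $ j))"
    using assms by (auto simp: scalar_prod_def reg_K_mat_def K_mat_def lessThan_atLeast0
        intro!: sum.cong)
  also have "\<dots> = (\<Sum>i<length xs. \<Sum>j<length xs. v $ i * v $ j * k (xs ! i) (xs ! j)) +
      (\<Sum>i<length xs. \<Sum>j<length xs. if i = j then \<eta> * (v $ i)\<^sup>2 else 0)"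
    unfolding sum_distrib_left sum.distrib[symmetric]
    by (intro sum.cong refl) (simp add: algebra_simps power2_eq_square)
  finally show ?thesis by (simp add: sum_distrib_left)
qed

lemma nonzero_vec_index:
  assumes "v \<in> carrier_vec n" "v \<noteq> 0\<^sub>v n"
  obtains i where "i < n" "v $ i \<noteq> (0::real)"
  using assms by (metis carrier_vecD eq_vecI index_zero_vec(1) index_zero_vec(2))

text \<open>For \<open>\<eta> > 0\<close>, and for \<open>\<eta> = 0\<close> with distinct points and a strictly positive definite kernel,
  \<^const>\<open>mat_inv\<close> is a genuine inverse.\<close>

lemma reg_K_mat_inverse:
  assumes pd: "positive_definite_kernel k" and "\<eta> > 0"
  shows "reg_K_mat k xs \<eta> * mat_inv (reg_K_mat k xs \<eta>) = 1\<^sub>m (length xs)"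
    and "mat_inv (reg_K_mat k xs \<eta>) * reg_K_mat k xs \<eta> = 1\<^sub>m (length xs)"
proof -
  have "0 < v \<bullet> (reg_K_mat k xs \<eta> *\<^sub>v v)"
    if v: "v \<in> carrier_vec (length xs)" "v \<noteq> 0\<^sub>v (length xs)" for v
  proof -
    obtain i where i: "i < length xs" "v $ i \<noteq> 0"
      using nonzero_vec_index[OF v] .
    have "0 < (\<Sum>i<length xs. (v $ i)\<^sup>2)"
      by (rule sum_pos2[of _ i]) (use i in auto)
    moreover have "0 \<le> (\<Sum>i<length xs. \<Sum>j<length xs. v $ i * v $ j * k (xs ! i) (xs ! j))"
      using pd unfolding positive_definite_kernel_def by auto
    ultimately show ?thesis
      using \<open>\<eta> > 0\<close> by (simp add: reg_K_mat_form[OF v(1)] add_nonneg_pos)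
  qed
  then show "reg_K_mat k xs \<eta> * mat_inv (reg_K_mat k xs \<eta>) = 1\<^sub>m (length xs)"
    and "mat_inv (reg_K_mat k xs \<eta>) * reg_K_mat k xs \<eta> = 1\<^sub>m (length xs)"
    using mat_inv_posdef[OF reg_K_mat_carrier] by blast+
qed

lemma reg_K_mat_inverse_strict:
  assumes strict: "\<And>(n::nat) x (c :: nat \<Rightarrow> real). inj_on x {..<n} \<Longrightarrow> \<exists>i<n. c i \<noteq> 0 \<Longrightarrow>
      0 < (\<Sum>i<n. \<Sum>j<n. c i * c j * k (x i) (x j))"
    and "\<eta> \<ge> 0" "distinct xs"
  shows "reg_K_mat k xs \<eta> * mat_inv (reg_K_mat k xs \<eta>) = 1\<^sub>m (length xs)"
    and "mat_inv (reg_K_mat k xs \<eta>) * reg_K_mat k xs \<eta> = 1\<^sub>m (length xs)"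
proof -
  have "0 < v \<bullet> (reg_K_mat k xs \<eta> *\<^sub>v v)"
    if v: "v \<in> carrier_vec (length xs)" "v \<noteq> 0\<^sub>v (length xs)" for v
  proof -
    obtain i where i: "i < length xs" "v $ i \<noteq> 0"
      using nonzero_vec_index[OF v] .
    have "inj_on (\<lambda>i. xs ! i) {..<length xs}"
      using \<open>distinct xs\<close> by (auto simp: inj_on_def nth_eq_iff_index_eq)
    then have "0 < (\<Sum>i<length xs. \<Sum>j<length xs. v $ i * v $ j * k (xs ! i) (xs ! j))"
      using strict[of "\<lambda>i. xs ! i" "length xs" "\<lambda>i. v $ i"] i by blast
    then show ?thesis
      using \<open>\<eta> \<ge> 0\<close> by (simp add: reg_K_mat_form[OF v(1)] add_pos_nonneg sum_nonneg)
  qed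
  then show "reg_K_mat k xs \<eta> * mat_inv (reg_K_mat k xs \<eta>) = 1\<^sub>m (length xs)"
    and "mat_inv (reg_K_mat k xs \<eta>) * reg_K_mat k xs \<eta> = 1\<^sub>m (length xs)"
    using mat_inv_posdef[OF reg_K_mat_carrier] by blast+
qed

end

theory Submission
  imports Defs
begin

text \<open>
  Put \<open>\<alpha> = (K + \<eta> I)\<^sup>-\<^sup>1 k_N(t)\<close>. The residual \<open>k_m(x, t) - k_{N,m}(x)\<^sup>T \<alpha>\<close> of the truncated kernel
  is linear in the basis functions of \<open>x\<close>: exchanging the sum over the design points with the sum
  over the basis gives \<open>\<Sum>a. w a * h a * \<phi> a x\<close>, where \<open>w a\<close> is the spectral density at the
  frequency of \<open>\<phi> a\<close> (\<open>hsgp_residual_expansion\<close>). The square of such a sum integrates to the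
  quadratic form of the Gram matrix at the vector \<open>W h\<close>, because each product \<open>\<phi> a * \<phi> b\<close> is
  integrable over the cube (\<open>hsgp_imse_quadratic_form\<close>).

  The Gram matrix is a Kronecker power because every \<open>\<phi> a\<close> is a product of one-dimensional sines in
  the separate coordinates and the cube is a product of intervals. By Fubini
  (\<open>integral_cube_prod\<close>) its entries are products of entries of \<open>G\<^sub>1\<close>. On the other side, reading
  a row and a column index of a Kronecker power in base \<open>m\<close> exhibits its entry as the product of the
  entries of the factor at the corresponding digits (\<open>kronecker_power_entry\<close>), and the lexicographic
  position of a multi-index is by definition the number with these digits, each index being shifted
  from \<open>1, \<dots>, m\<close> to \<open>0, \<dots>, m - 1\<close>.

  The entries of \<open>G\<^sub>1\<close> themselves come from the product-to-sum formula for sines and the fundamental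
  theorem of calculus.
\<close>


section \<open>Integrals of separable functions over the cube\<close>

text \<open>Lebesgue measure on a Euclidean space is the image of a product measure, so this is Fubini's
  theorem for a product of functions of single coordinates.\<close>

lemma lborel_separable_integral:
  fixes f :: "'a::euclidean_space \<Rightarrow> real \<Rightarrow> real"
  assumes f: "\<And>b. b \<in> Basis \<Longrightarrow> integrable lborel (f b)"
  shows "integrable lborel (\<lambda>x. \<Prod>b\<in>Basis. f b (inner x b))"
    and "(LINT x|lborel. (\<Prod>b\<in>Basis. f b (inner x b))) = (\<Prod>b\<in>Basis. LINT y|lborel. f b y)"
proof -
  interpret product_sigma_finite "\<lambda>_::'a. lborel :: real measure" ..
  let ?P = "\<Pi>\<^sub>M b\<in>(Basis::'a set). (lborel :: real measure)"
  let ?g = "\<lambda>y::'a \<Rightarrow> real. \<Sum>b\<in>Basis. y b *\<^sub>R b"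
  have [measurable]: "f b \<in> borel_measurable borel" if "b \<in> Basis" for b
    using borel_measurable_integrable[OF f[OF that]] by simp
  have meas: "(\<lambda>x::'a. \<Prod>b\<in>Basis. f b (inner x b)) \<in> borel_measurable borel"
    by measurable
  have g: "?g \<in> measurable ?P borel"
    by measurable
  have coord: "(\<Prod>b\<in>Basis. f b (inner (?g y) b)) = (\<Prod>b\<in>Basis. f b (y b))" for y
    by (intro prod.cong refl) simp
  have "integrable ?P (\<lambda>y. \<Prod>b\<in>Basis. f b (y b))"
    by (rule product_integrable_prod) (use f in auto)
  then show "integrable lborel (\<lambda>x. \<Prod>b\<in>Basis. f b (inner x b))"
    by (subst lborel_eq, subst integrable_distr_eq[OF g meas]) (simp only: coord)
  have "(LINT y|?P. (\<Prod>b\<in>Basis. f b (y b))) = (\<Prod>b\<in>Basis. LINT y|lborel. f b y)"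
    by (rule product_integral_prod) (use f in auto)
  then show "(LINT x|lborel. (\<Prod>b\<in>Basis. f b (inner x b))) = (\<Prod>b\<in>Basis. LINT y|lborel. f b y)"
    by (subst lborel_eq, subst integral_distr[OF g meas]) (simp only: coord)
qed

lemma lborel_cart_separable_integral:
  fixes f :: "'d::finite \<Rightarrow> real \<Rightarrow> real"
  assumes f: "\<And>r. integrable lborel (f r)"
  shows "integrable lborel (\<lambda>x::real^'d. \<Prod>r\<in>UNIV. f r (x $h r))"
    and "(LINT x|lborel. (\<Prod>r\<in>UNIV. f r ((x::real^'d) $h r))) = (\<Prod>r\<in>UNIV. LINT y|lborel. f r y)"
proof -
  let ?axis = "\<lambda>r::'d. axis r (1::real)"
  have bij: "bij_betw ?axis UNIV Basis"
    by (auto simp: bij_betw_def inj_on_def Basis_vec_def axis_eq_axis)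
  have inv: "inv_into UNIV ?axis (?axis r) = r" for r
    by (rule inv_f_f) (auto simp: inj_on_def axis_eq_axis)
  have reindex: "(\<Prod>b\<in>Basis. u (inv_into UNIV ?axis b) b) = (\<Prod>r\<in>UNIV. u r (?axis r))"
    for u :: "'d \<Rightarrow> real^'d \<Rightarrow> real"
    by (subst prod.reindex_bij_betw[OF bij, symmetric]) (simp only: inv)
  note separable = lborel_separable_integral[where f = "\<lambda>b::real^'d. f (inv_into UNIV ?axis b)", OF f]
  show "integrable lborel (\<lambda>x::real^'d. \<Prod>r\<in>UNIV. f r (x $h r))"
    using separable(1) by (simp add: reindex[of "\<lambda>r b. f r (inner _ b)"] inner_axis)
  show "(LINT x|lborel. (\<Prod>r\<in>UNIV. f r ((x::real^'d) $h r))) = (\<Prod>r\<in>UNIV. LINT y|lborel. f r y)"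
    using separable(2)
    by (simp add: reindex[of "\<lambda>r b. f r (inner _ b)"] reindex[of "\<lambda>r b. LINT y|lborel. f r y"]
        inner_axis)
qed

text \<open>The indicator of the cube is the product of the indicators of its sides, so restricting the
  integral to the cube keeps the integrand separable.\<close>

lemma integral_cube_prod:
  fixes g :: "'d::finite \<Rightarrow> real \<Rightarrow> real" and B :: real
  assumes g: "\<And>r. continuous_on UNIV (g r)"
  shows "integrable (lebesgue_on (cube B)) (\<lambda>x. \<Prod>r\<in>UNIV. g r (x $h r))"
    and "(LINT x|lebesgue_on (cube B). (\<Prod>r\<in>UNIV. g r (x $h r)))
       = (\<Prod>r\<in>(UNIV::'d set). LINT y|lebesgue_on {-B..B}. g r y)"
proof -
  define f where "f r y = indicator {-B<..<B} y *\<^sub>R g r y" for r y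
  have [measurable]: "g r \<in> borel_measurable borel" for r
    using g by (rule borel_measurable_continuous_onI)
  have "cube B = box (\<chi> r. - B) ((\<chi> r. B) :: real^'d)"
    by (auto simp: cube_def mem_box_cart)
  then have cube: "(cube B :: (real^'d) set) \<in> sets borel"
    by simp
  have f: "integrable lborel (f r)" for r
  proof -
    have "set_integrable lborel {-B..B} (g r)"
      by (intro borel_integrable_atLeastAtMost' continuous_on_subset[OF g]) auto
    then have "set_integrable lborel {-B<..<B} (g r)"
      by (rule set_integrable_subset) auto
    then show ?thesis
      by (simp add: set_integrable_def f_def[abs_def])
  qed
  have ind: "indicator (cube B) x *\<^sub>R (\<Prod>r\<in>UNIV. g r (x $h r)) = (\<Prod>r\<in>UNIV. f r (x $h r))"
    for x :: "real^'d"
  proof (cases "x \<in> cube B")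
    case True
    then show ?thesis by (auto simp: cube_def f_def)
  next
    case False
    then obtain r where "x $h r \<notin> {-B<..<B}" by (auto simp: cube_def)
    then have "f r (x $h r) = 0" by (simp add: f_def)
    then have "(\<Prod>r\<in>UNIV. f r (x $h r)) = 0"
      by (intro prod_zero bexI[of _ r]) auto
    with False show ?thesis by simp
  qed
  have meas: "(\<lambda>x::real^'d. \<Prod>r\<in>UNIV. f r (x $h r)) \<in> borel_measurable lborel"
    using borel_measurable_integrable[OF lborel_cart_separable_integral(1)[OF f]] .
  have "integrable lebesgue (\<lambda>x. \<Prod>r\<in>UNIV. f r ((x::real^'d) $h r))"
    by (subst integrable_completion[OF meas]) (rule lborel_cart_separable_integral(1)[OF f])
  then show "integrable (lebesgue_on (cube B)) (\<lambda>x. \<Prod>r\<in>UNIV. g r (x $h r))"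
    using cube by (subst integrable_restrict_space) (auto simp: ind[simplified])
  have interval: "(LINT y|lborel. f r y) = (LINT y|lebesgue_on {-B..B}. g r y)" for r
  proof -
    have "(LINT y|lebesgue_on {-B..B}. g r y) = (LINT y|lborel. indicator {-B..B} y *\<^sub>R g r y)"
      by (subst integral_restrict_space, simp, subst integral_completion) auto
    \<comment> \<open>The open and the closed interval differ by two points, a null set.\<close>
    also have "\<dots> = (LINT y|lborel. f r y)"
      using AE_lborel_singleton[of B] AE_lborel_singleton[of "-B"]
      by (intro integral_cong_AE) (auto simp: f_def[abs_def] indicator_def)
    finally show ?thesis ..
  qed
  have "(LINT x|lebesgue_on (cube B). (\<Prod>r\<in>UNIV. g r (x $h r)))
      = (LINT x|lebesgue. (\<Prod>r\<in>UNIV. f r ((x::real^'d) $h r)))"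
    using cube by (subst integral_restrict_space) (auto simp: ind[simplified])
  also have "\<dots> = (LINT x|lborel. (\<Prod>r\<in>UNIV. f r ((x::real^'d) $h r)))"
    by (rule integral_completion[OF meas])
  also have "\<dots> = (\<Prod>r\<in>UNIV. LINT y|lborel. f r y)"
    by (rule lborel_cart_separable_integral(2)[OF f])
  also have "\<dots> = (\<Prod>r\<in>UNIV. LINT y|lebesgue_on {-B..B}. g r y)"
    by (simp only: interval)
  finally show "(LINT x|lebesgue_on (cube B). (\<Prod>r\<in>UNIV. g r (x $h r)))
       = (\<Prod>r\<in>(UNIV::'d set). LINT y|lebesgue_on {-B..B}. g r y)" .
qed


section \<open>Entries of Kronecker powers\<close>

text \<open>The sum is the value of the base-\<open>m\<close> numeral with digits \<open>f 0, \<dots>, f (n - 1)\<close>, the most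
  significant one first, matching the order of the blocks in \<^const>\<open>kronecker_power\<close>.\<close>

lemma digits_less_power:
  fixes f :: "nat \<Rightarrow> nat"
  assumes "\<And>r. r < n \<Longrightarrow> f r < m"
  shows "(\<Sum>r<n. f r * m ^ (n - Suc r)) < m ^ n"
  using assms
proof (induction n arbitrary: f)
  case (Suc n)
  have "(\<Sum>r<n. f (Suc r) * m ^ (n - Suc r)) < m ^ n"
    by (rule Suc.IH) (use Suc.prems in auto)
  then have "(\<Sum>r<Suc n. f r * m ^ (Suc n - Suc r)) < f 0 * m ^ n + m ^ n"
    unfolding sum.lessThan_Suc_shift by simp
  also have "\<dots> = Suc (f 0) * m ^ n"
    by simp
  also have "\<dots> \<le> m * m ^ n"
    by (intro mult_right_mono) (use Suc.prems[of 0] in auto)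
  finally show ?case by simp
qed simp

lemma kronecker_power_carrier:
  assumes "A \<in> carrier_mat m m"
  shows "kronecker_power A n \<in> carrier_mat (m ^ n) (m ^ n)"
  using assms by (induction n) (auto simp: kronecker_def)

text \<open>The outer factor of a Kronecker product is selected by the quotient of the index by the size of
  the inner one, that is by the leading digit, and the inner factor by the remaining digits.\<close>

lemma kronecker_power_entry:
  fixes f g :: "nat \<Rightarrow> nat"
  assumes A: "A \<in> carrier_mat m m"
    and "\<And>r. r < n \<Longrightarrow> f r < m" "\<And>r. r < n \<Longrightarrow> g r < m"
  shows "kronecker_power A n $$ (\<Sum>r<n. f r * m ^ (n - Suc r), \<Sum>r<n. g r * m ^ (n - Suc r))
    = (\<Prod>r<n. A $$ (f r, g r))"
  using assms(2,3)
proof (induction n arbitrary: f g)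
  case (Suc n)
  define i where "i = (\<Sum>r<n. f (Suc r) * m ^ (n - Suc r))"
  define j where "j = (\<Sum>r<n. g (Suc r) * m ^ (n - Suc r))"
  have tail: "i < m ^ n" "j < m ^ n"
    unfolding i_def j_def by (rule digits_less_power; use Suc.prems in simp)+
  have split: "(\<Sum>r<Suc n. f r * m ^ (Suc n - Suc r)) = f 0 * m ^ n + i"
    "(\<Sum>r<Suc n. g r * m ^ (Suc n - Suc r)) = g 0 * m ^ n + j"
    unfolding sum.lessThan_Suc_shift i_def j_def by simp_all
  have bound: "f 0 * m ^ n + i < m * m ^ n" "g 0 * m ^ n + j < m * m ^ n"
    using digits_less_power[of "Suc n" f m] digits_less_power[of "Suc n" g m] Suc.prems
    unfolding split by simp_all
  have carr: "kronecker_power A n \<in> carrier_mat (m ^ n) (m ^ n)"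
    by (rule kronecker_power_carrier[OF A])
  have quotient: "(u * w + v) div w = u" if "v < w" for u v w :: nat
    using that by simp
  have "kronecker_power A (Suc n) $$ (f 0 * m ^ n + i, g 0 * m ^ n + j)
      = A $$ (f 0, g 0) * kronecker_power A n $$ (i, j)"
    using A carr tail bound by (simp add: kronecker_def quotient del: div_mult_self3 div_mult_self4)
  also have "kronecker_power A n $$ (i, j) = (\<Prod>r<n. A $$ (f (Suc r), g (Suc r)))"
    unfolding i_def j_def by (rule Suc.IH) (use Suc.prems in auto)
  finally show ?case
    unfolding split prod.lessThan_Suc_shift by simp
qed simp

lemma kronecker_power_ordered_entry:
  fixes e :: "nat \<Rightarrow> 'd::finite \<Rightarrow> nat"
  assumes A: "A \<in> carrier_mat m m"
    and c: "bij_betw c {..<CARD('d)} UNIV"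
    and ab: "a < m ^ CARD('d)" "b < m ^ CARD('d)"
    and e: "e a \<in> multi_indices m" "e b \<in> multi_indices m"
  shows "kronecker_power_ordered m c e A $$ (a, b) = (\<Prod>r\<in>UNIV. A $$ (e a r - 1, e b r - 1))"
proof -
  have digit: "j r - 1 < m" if "j \<in> multi_indices m" for j :: "'d \<Rightarrow> nat" and r
  proof -
    have "j r \<in> {1..m}" using that by (simp add: multi_indices_def)
    then show ?thesis by auto
  qed
  have "kronecker_power_ordered m c e A $$ (a, b)
      = (\<Prod>r<CARD('d). A $$ (e a (c r) - 1, e b (c r) - 1))"
    using ab kronecker_power_entry[OF A, where f = "\<lambda>r. e a (c r) - 1" and g = "\<lambda>r. e b (c r) - 1",
        OF digit[OF e(1)] digit[OF e(2)]]
    by (simp add: kronecker_power_ordered_def lex_position_def)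
  also have "\<dots> = (\<Prod>r\<in>UNIV. A $$ (e a r - 1, e b r - 1))"
    by (rule prod.reindex_bij_betw[OF c])
  finally show ?thesis .
qed

lemma kronecker_power_ordered_lex:
  fixes e :: "nat \<Rightarrow> 'd::finite \<Rightarrow> nat"
  assumes A: "A \<in> carrier_mat m m"
    and lex: "\<And>a. a < m ^ CARD('d) \<Longrightarrow> lex_position m c (e a) = a"
  shows "kronecker_power_ordered m c e A = kronecker_power A CARD('d)"
  using kronecker_power_carrier[OF A, of "CARD('d)"]
  by (intro eq_matI) (auto simp: kronecker_power_ordered_def lex)


section \<open>The Gram matrix of the sine basis\<close>

lemma sine_basis_eq_prod:
  fixes j :: "'d::finite \<Rightarrow> nat"
  assumes "L > 0"
  shows "sine_basis L j x = (\<Prod>r\<in>UNIV. sine_basis_1 L (j r) (x $h r))"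
  using assms by (simp add: sine_basis_def sine_basis_1_def prod.distrib powr_power)

lemma continuous_on_sine_basis_1: "continuous_on A (sine_basis_1 L p)"
  unfolding sine_basis_1_def by (intro continuous_intros)

lemma integrable_sine_basis_mult:
  fixes i j :: "'d::finite \<Rightarrow> nat"
  assumes "L > 0"
  shows "integrable (lebesgue_on (cube B)) (\<lambda>x. sine_basis L i x * sine_basis L j x)"
  using assms
  by (simp add: sine_basis_eq_prod flip: prod.distrib)
    (intro integral_cube_prod continuous_on_mult continuous_on_sine_basis_1)

lemma gram_mat_entry:
  fixes e :: "nat \<Rightarrow> 'd::finite \<Rightarrow> nat"
  assumes L: "L > 0"
    and ab: "a < m ^ CARD('d)" "b < m ^ CARD('d)"
    and e: "e a \<in> multi_indices m" "e b \<in> multi_indices m"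
  shows "gram_mat (lebesgue_on (cube B)) L m e $$ (a, b)
    = (\<Prod>r\<in>UNIV. gram_mat_1 B L m $$ (e a r - 1, e b r - 1))"
proof -
  have "gram_mat (lebesgue_on (cube B)) L m e $$ (a, b) = (LINT x|lebesgue_on (cube B).
      (\<Prod>r\<in>UNIV. sine_basis_1 L (e a r) (x $h r) * sine_basis_1 L (e b r) (x $h r)))"
    using ab L by (simp add: gram_mat_def sine_basis_eq_prod prod.distrib)
  also have "\<dots> = (\<Prod>r\<in>UNIV. LINT y|lebesgue_on {-B..B}.
      sine_basis_1 L (e a r) y * sine_basis_1 L (e b r) y)"
    by (intro integral_cube_prod continuous_on_mult continuous_on_sine_basis_1)
  also have "\<dots> = (\<Prod>r\<in>UNIV. gram_mat_1 B L m $$ (e a r - 1, e b r - 1))"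
  proof (intro prod.cong refl)
    fix r
    have "e a r \<in> {1..m}" "e b r \<in> {1..m}"
      using e by (auto simp: multi_indices_def)
    then show "(LINT y|lebesgue_on {-B..B}. sine_basis_1 L (e a r) y * sine_basis_1 L (e b r) y)
      = gram_mat_1 B L m $$ (e a r - 1, e b r - 1)"
      by (auto simp: gram_mat_1_def)
  qed
  finally show ?thesis .
qed

text \<open>An entry of either matrix is the product over the coordinates of entries of the
  one-dimensional Gram matrix: on the left by Fubini, on the right by reading the lexicographic
  positions digit by digit.\<close>

lemma gram_mat_eq_kronecker_power_ordered:
  fixes e :: "nat \<Rightarrow> 'd::finite \<Rightarrow> nat"
  assumes L: "L > 0" and c: "bij_betw c {..<CARD('d)} UNIV"
    and e: "bij_betw e {..<m ^ CARD('d)} (multi_indices m)"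
  shows "gram_mat (lebesgue_on (cube B)) L m e = kronecker_power_ordered m c e (gram_mat_1 B L m)"
proof (intro eq_matI)
  fix a b
  assume "a < dim_row (kronecker_power_ordered m c e (gram_mat_1 B L m))"
    "b < dim_col (kronecker_power_ordered m c e (gram_mat_1 B L m))"
  then have ab: "a < m ^ CARD('d)" "b < m ^ CARD('d)"
    by (auto simp: kronecker_power_ordered_def)
  then have eab: "e a \<in> multi_indices m" "e b \<in> multi_indices m"
    using e by (auto simp: bij_betw_def)
  have "gram_mat_1 B L m \<in> carrier_mat m m"
    by (simp add: gram_mat_1_def)
  from kronecker_power_ordered_entry[OF this c ab eab] gram_mat_entry[OF L ab eab]
  show "gram_mat (lebesgue_on (cube B)) L m e $$ (a, b)
      = kronecker_power_ordered m c e (gram_mat_1 B L m) $$ (a, b)"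
    by simp
qed (auto simp: gram_mat_def kronecker_power_ordered_def)


section \<open>The one-dimensional Gram matrix\<close>

lemma integral_Icc_antiderivative:
  fixes F f :: "real \<Rightarrow> real"
  assumes "a \<le> b" "\<And>x. (F has_real_derivative f x) (at x)" "continuous_on {a..b} f"
  shows "(LINT x|lebesgue_on {a..b}. f x) = F b - F a"
proof -
  have "(LINT x|lebesgue_on {a..b}. f x) = integral {a..b} f"
    by (intro lebesgue_integral_eq_integral continuous_imp_integrable_real assms) auto
  also have "\<dots> = F b - F a"
    using assms(1,2) by (intro integral_unique fundamental_theorem_of_calculus)
      (auto simp: has_real_derivative_iff_has_vector_derivative intro: has_vector_derivative_at_within)
  finally show ?thesis .
qed

text \<open>The product-to-sum formula \<open>2 sin u sin v = cos (u - v) - cos (u + v)\<close>.\<close>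

lemma sine_basis_1_mult:
  assumes "L > 0"
  shows "sine_basis_1 L p x * sine_basis_1 L q x =
    1 / (2 * L) * (cos (pi / (2 * L) * (real p - real q) * (L + x))
      - cos (pi / (2 * L) * (real p + real q) * (L + x)))"
proof -
  have "sine_basis_1 L p x * sine_basis_1 L q x = (L powr (- 1 / 2) * L powr (- 1 / 2)) *
      (sin (pi * real p / (2 * L) * (x + L)) * sin (pi * real q / (2 * L) * (x + L)))"
    by (simp only: sine_basis_1_def mult_ac)
  also have "L powr (- 1 / 2) * L powr (- 1 / 2) = 1 / L"
    using assms by (simp add: powr_minus_divide flip: powr_add)
  also have "1 / L * (sin (pi * real p / (2 * L) * (x + L)) * sin (pi * real q / (2 * L) * (x + L)))
      = 1 / L * (1 / 2 * (cos (pi * real p / (2 * L) * (x + L) - pi * real q / (2 * L) * (x + L))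
      - cos (pi * real p / (2 * L) * (x + L) + pi * real q / (2 * L) * (x + L))))"
    unfolding sin_times_sin by simp
  also have "\<dots> = 1 / (2 * L) * (cos (pi * real p / (2 * L) * (x + L) - pi * real q / (2 * L) * (x + L))
      - cos (pi * real p / (2 * L) * (x + L) + pi * real q / (2 * L) * (x + L)))"
    by simp
  also have "pi * real p / (2 * L) * (x + L) - pi * real q / (2 * L) * (x + L)
      = pi / (2 * L) * (real p - real q) * (L + x)"
    using assms by (simp add: field_simps)
  also have "pi * real p / (2 * L) * (x + L) + pi * real q / (2 * L) * (x + L)
      = pi / (2 * L) * (real p + real q) * (L + x)"
    using assms by (simp add: field_simps)
  finally show ?thesis .
qed

lemma integral_sine_basis_1_square:
  assumes "B > 0" "L > 0" "p > 0"
  shows "(LINT x|lebesgue_on {-B..B}. sine_basis_1 L p x * sine_basis_1 L p x) =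
    B / L - 1 / (2 * pi * real p) * (sin (pi * real p / L * (L + B)) - sin (pi * real p / L * (L - B)))"
proof -
  define F where "F x = x / (2 * L) - 1 / (2 * pi * real p) * sin (pi * real p / L * (L + x))" for x
  have "(F has_real_derivative sine_basis_1 L p x * sine_basis_1 L p x) (at x)" for x
    unfolding F_def[abs_def] sine_basis_1_mult[OF \<open>L > 0\<close>] using assms
    by (auto intro!: derivative_eq_intros simp: field_simps)
  then have "(LINT x|lebesgue_on {-B..B}. sine_basis_1 L p x * sine_basis_1 L p x) = F B - F (- B)"
    using assms
    by (intro integral_Icc_antiderivative continuous_on_mult continuous_on_sine_basis_1) auto
  also have "\<dots> = B / L - 1 / (2 * pi * real p) *
      (sin (pi * real p / L * (L + B)) - sin (pi * real p / L * (L - B)))"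
    unfolding F_def using assms by (simp add: right_diff_distrib)
  finally show ?thesis .
qed

lemma integral_sine_basis_1_mult:
  assumes "B > 0" "L > 0" "p \<noteq> q"
  defines "F \<equiv> \<lambda>s. 1 / pi *
      (1 / (real p - real q) * sin (pi / (2 * L) * (real p - real q) * s)
       - 1 / (real p + real q) * sin (pi / (2 * L) * (real p + real q) * s))"
  shows "(LINT x|lebesgue_on {-B..B}. sine_basis_1 L p x * sine_basis_1 L q x) = F (L + B) - F (L - B)"
proof -
  have deriv_sin: "((\<lambda>x. 1 / pi * (1 / k * sin (pi / (2 * L) * k * (L + x)))) has_real_derivative
      1 / (2 * L) * cos (pi / (2 * L) * k * (L + x))) (at x)" if "k \<noteq> 0" for k x
    using that \<open>L > 0\<close> by (auto intro!: derivative_eq_intros simp: field_simps)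
  have "real p - real q \<noteq> 0" "real p + real q \<noteq> 0"
    using \<open>p \<noteq> q\<close> by auto
  then have "((\<lambda>x. F (L + x)) has_real_derivative sine_basis_1 L p x * sine_basis_1 L q x) (at x)" for x
    unfolding F_def sine_basis_1_mult[OF \<open>L > 0\<close>]
      right_diff_distrib[of "1 / pi"] right_diff_distrib[of "1 / (2 * L)"]
    by (intro DERIV_diff deriv_sin)
  then have "(LINT x|lebesgue_on {-B..B}. sine_basis_1 L p x * sine_basis_1 L q x)
      = F (L + B) - F (L + - B)"
    using assms(1)
    by (intro integral_Icc_antiderivative continuous_on_mult continuous_on_sine_basis_1) auto
  then show ?thesis by simp
qed


section \<open>The approximate acquisition function as a quadratic form\<close>

text \<open>The default value for singular matrices has the right size too, so the weight vector obtained
  by applying \<^const>\<open>mat_inv\<close> to \<open>k_N(t)\<close> always has one entry per design point.\<close>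

lemma mat_inv_carrier:
  assumes "A \<in> carrier_mat n n"
  shows "mat_inv A \<in> carrier_mat n n"
  using assms mat_inverse(2)[OF assms] by (auto simp: mat_inv_def split: option.split)

lemma diagonal_conjugate_form:
  fixes A :: "real mat"
  assumes A: "A \<in> carrier_mat n n" and h: "h \<in> carrier_vec n"
  shows "h \<bullet> ((mat_diag n w * A * mat_diag n w) *\<^sub>v h)
    = (\<Sum>a<n. \<Sum>b<n. (w a * h $ a) * (w b * h $ b) * A $$ (a, b))"
proof -
  have "mat_diag n w * A * mat_diag n w = mat n n (\<lambda>(a, b). w a * A $$ (a, b) * w b)"
    using A by (auto simp: mat_diag_mult_left[OF A] mat_diag_mult_right[of _ n n])
  then show ?thesis
    using h by (auto simp: scalar_prod_def sum_distrib_left lessThan_atLeast0 algebra_simps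
        intro!: sum.cong)
qed

lemma hsgp_kernel_eq_sum_ordered:
  fixes e :: "nat \<Rightarrow> 'd::finite \<Rightarrow> nat"
  assumes "bij_betw e {..<m ^ CARD('d)} (multi_indices m)"
  shows "hsgp_kernel S L m x x' =
    (\<Sum>a<m ^ CARD('d). S (frequency L (e a)) * sine_basis L (e a) x * sine_basis L (e a) x')"
  unfolding hsgp_kernel_def by (rule sum.reindex_bij_betw[OF assms, symmetric])

lemma h_vec_index:
  fixes e :: "nat \<Rightarrow> 'd::finite \<Rightarrow> nat" and k :: "real ^ 'd \<Rightarrow> real ^ 'd \<Rightarrow> real"
    and xs :: "(real ^ 'd) list" and \<eta> :: real and t :: "real ^ 'd"
  defines "\<alpha> \<equiv> mat_inv (reg_K_mat k xs \<eta>) *\<^sub>v k_vec k xs t"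
  assumes "a < m ^ CARD('d)"
  shows "h_vec k L m e xs \<eta> t $ a =
    sine_basis L (e a) t - (\<Sum>n<length xs. sine_basis L (e a) (xs ! n) * \<alpha> $ n)"
proof -
  have "dim_vec (\<alpha>) = length xs"
    using mat_inv_carrier[OF reg_K_mat_carrier, of k xs \<eta>] by (simp add: \<alpha>_def)
  moreover have "((design_mat L m e xs)\<^sup>T *\<^sub>v v) $ a
      = (\<Sum>n<length xs. sine_basis L (e a) (xs ! n) * v $ n)" if "dim_vec v = length xs" for v
    using that assms(2) by (simp add: design_mat_def scalar_prod_def lessThan_atLeast0)
  moreover have "h_vec k L m e xs \<eta> t $ a
      = sine_basis L (e a) t - ((design_mat L m e xs)\<^sup>T *\<^sub>v \<alpha>) $ a"
    using assms(2) unfolding h_vec_def \<alpha>_def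
    by (subst index_minus_vec) (simp_all add: basis_vec_def design_mat_def)
  ultimately show ?thesis by simp
qed

text \<open>Both kernel terms are linear in the basis functions of \<open>x\<close>; collecting the coefficient of each
  basis function yields a spectral weight times a component of \<^const>\<open>h_vec\<close>.\<close>

lemma hsgp_residual_expansion:
  fixes e :: "nat \<Rightarrow> 'd::finite \<Rightarrow> nat"
  assumes e: "bij_betw e {..<m ^ CARD('d)} (multi_indices m)"
  shows "hsgp_kernel S L m x t
      - k_vec (hsgp_kernel S L m) xs x \<bullet> (mat_inv (reg_K_mat k xs \<eta>) *\<^sub>v k_vec k xs t)
    = (\<Sum>a<m ^ CARD('d). S (frequency L (e a)) * h_vec k L m e xs \<eta> t $ a * sine_basis L (e a) x)"
proof -
  define \<alpha> where "\<alpha> = mat_inv (reg_K_mat k xs \<eta>) *\<^sub>v k_vec k xs t"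
  let ?w = "\<lambda>a. S (frequency L (e a))"
  have dim: "dim_vec \<alpha> = length xs"
    using mat_inv_carrier[OF reg_K_mat_carrier, of k xs \<eta>] by (simp add: \<alpha>_def)
  have "k_vec (hsgp_kernel S L m) xs x \<bullet> \<alpha>
      = (\<Sum>n<length xs. \<Sum>a<m ^ CARD('d). ?w a * sine_basis L (e a) x * sine_basis L (e a) (xs ! n) * \<alpha> $ n)"
    by (simp add: scalar_prod_def k_vec_def dim lessThan_atLeast0 sum_distrib_right
        hsgp_kernel_eq_sum_ordered[OF e])
  also have "\<dots> = (\<Sum>a<m ^ CARD('d). ?w a * sine_basis L (e a) x
      * (\<Sum>n<length xs. sine_basis L (e a) (xs ! n) * \<alpha> $ n))"
    by (subst sum.swap) (simp add: sum_distrib_left mult.assoc)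
  finally have "hsgp_kernel S L m x t - k_vec (hsgp_kernel S L m) xs x \<bullet> \<alpha>
      = (\<Sum>a<m ^ CARD('d). ?w a * sine_basis L (e a) x *
          (sine_basis L (e a) t - (\<Sum>n<length xs. sine_basis L (e a) (xs ! n) * \<alpha> $ n)))"
    by (simp add: hsgp_kernel_eq_sum_ordered[OF e] right_diff_distrib sum_subtractf)
  also have "\<dots> = (\<Sum>a<m ^ CARD('d). ?w a * h_vec k L m e xs \<eta> t $ a * sine_basis L (e a) x)"
    by (intro sum.cong refl) (simp add: h_vec_index \<alpha>_def)
  finally show ?thesis by (simp add: \<alpha>_def)
qed

text \<open>The integral of a squared linear combination is the quadratic form of the Gram matrix
  \<open>LINT x|M. \<phi> a x * \<phi> b x\<close>; integrability of the products licenses the interchange of the double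
  sum with the integral.\<close>

lemma integral_square_of_sum:
  fixes v :: "nat \<Rightarrow> real" and \<phi> :: "nat \<Rightarrow> 'a \<Rightarrow> real"
  assumes int: "\<And>a b. integrable M (\<lambda>x. \<phi> a x * \<phi> b x)"
  shows "(LINT x|M. (\<Sum>a<n. v a * \<phi> a x)\<^sup>2) = (\<Sum>a<n. \<Sum>b<n. v a * v b * (LINT x|M. \<phi> a x * \<phi> b x))"
proof -
  have "(\<Sum>a<n. v a * \<phi> a x)\<^sup>2 = (\<Sum>a<n. \<Sum>b<n. v a * v b * (\<phi> a x * \<phi> b x))" for x
    by (simp add: power2_eq_square sum_product algebra_simps)
  then show ?thesis
    using int by (simp add: Bochner_Integration.integral_sum)
qed

lemma hsgp_imse_quadratic_form:
  fixes e :: "nat \<Rightarrow> 'd::finite \<Rightarrow> nat" and t :: "real ^ 'd" and B \<eta> :: real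
    and S :: "real ^ 'd \<Rightarrow> real" and k :: "real ^ 'd \<Rightarrow> real ^ 'd \<Rightarrow> real"
    and xs :: "(real ^ 'd) list"
  assumes L: "L > 0" and e: "bij_betw e {..<m ^ CARD('d)} (multi_indices m)"
  defines "P \<equiv> lebesgue_on (cube B)"
    and "W \<equiv> spectral_mat S L m e" and "h \<equiv> h_vec k L m e xs \<eta> t"
  shows "hsgp_imse P k S L m xs \<eta> t =
    (h \<bullet> ((W * gram_mat P L m e * W) *\<^sub>v h)) / ((power_function k xs \<eta> t)\<^sup>2 + \<eta>)"
proof -
  let ?v = "\<lambda>a. S (frequency L (e a)) * h $ a"
  have "gram_mat P L m e \<in> carrier_mat (m ^ CARD('d)) (m ^ CARD('d))"
    "h \<in> carrier_vec (m ^ CARD('d))"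
    by (auto simp: gram_mat_def h_def h_vec_def design_mat_def intro!: carrier_vecI)
  then have "h \<bullet> ((W * gram_mat P L m e * W) *\<^sub>v h)
      = (\<Sum>a<m ^ CARD('d). \<Sum>b<m ^ CARD('d). ?v a * ?v b * gram_mat P L m e $$ (a, b))"
    unfolding W_def spectral_mat_def by (rule diagonal_conjugate_form)
  also have "\<dots> = (\<Sum>a<m ^ CARD('d). \<Sum>b<m ^ CARD('d). ?v a * ?v b *
      (LINT x|P. sine_basis L (e a) x * sine_basis L (e b) x))"
    by (intro sum.cong refl) (simp add: gram_mat_def)
  also have "\<dots> = (LINT x|P. (\<Sum>a<m ^ CARD('d). ?v a * sine_basis L (e a) x)\<^sup>2)"
    unfolding P_def by (intro integral_square_of_sum[symmetric] integrable_sine_basis_mult L)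
  finally show ?thesis
    unfolding hsgp_imse_def hsgp_residual_expansion[OF e] h_def by simp
qed


theorem theorem2:
  fixes B L \<eta> :: real and m :: nat
    and k :: "real ^ 'd \<Rightarrow> real ^ 'd \<Rightarrow> real"
    and \<kappa> S :: "real ^ 'd \<Rightarrow> real"
    and xs :: "(real ^ 'd) list"
    and t :: "real ^ 'd"
    and P :: "(real ^ 'd) measure"
    and c :: "nat \<Rightarrow> 'd::finite"
    and e :: "nat \<Rightarrow> 'd \<Rightarrow> nat"
    and W G :: "real mat" and h :: "real vec"
  assumes "B > 0" and "L > 0" and "\<eta> \<ge> 0"
    and "P = lebesgue_on (cube B)"
    and "positive_definite_kernel k"
    and "shift_invariant_kernel k \<kappa>"
    and "has_spectral_density \<kappa> S"
    and "distinct xs" and "set xs \<subseteq> cube B"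
    and coordinates: "bij_betw c {..<CARD('d)} UNIV"
    and ordering: "bij_betw e {..<m ^ CARD('d)} (multi_indices m)"
    and "W = spectral_mat S L m e"
    and "G = gram_mat P L m e"
    and "h = h_vec k L m e xs \<eta> t"
    and "t \<in> cube B"
    and "(power_function k xs \<eta> t)\<^sup>2 + \<eta> > 0"
  shows
    "hsgp_imse P k S L m xs \<eta> t =
       (h \<bullet> ((W * G * W) *\<^sub>v h)) / ((power_function k xs \<eta> t)\<^sup>2 + \<eta>) \<and>
     (h \<bullet> ((W * G * W) *\<^sub>v h)) / ((power_function k xs \<eta> t)\<^sup>2 + \<eta>) =
       (h \<bullet> ((W * kronecker_power_ordered m c e (gram_mat_1 B L m) * W) *\<^sub>v h))
         / ((power_function k xs \<eta> t)\<^sup>2 + \<eta>) \<and>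
     ((\<forall>a<m ^ CARD('d). lex_position m c (e a) = a) \<longrightarrow>
        kronecker_power_ordered m c e (gram_mat_1 B L m) =
          kronecker_power (gram_mat_1 B L m) CARD('d)) \<and>
     (\<forall>p\<in>{1..m}. \<forall>q\<in>{1..m}.
        gram_mat_1 B L m $$ (p - 1, q - 1) =
          (LINT x|lebesgue_on {-B..B}. sine_basis_1 L p x * sine_basis_1 L q x) \<and>
        (LINT x|lebesgue_on {-B..B}. sine_basis_1 L p x * sine_basis_1 L q x) =
          (if p = q
           then B / L - 1 / (2 * pi * real p) *
                  (sin (pi * real p / L * (L + B)) - sin (pi * real p / L * (L - B)))
           else let F = (\<lambda>s. 1 / pi *
                    (1 / (real p - real q) * sin (pi / (2 * L) * (real p - real q) * s)
                     - 1 / (real p + real q) * sin (pi / (2 * L) * (real p + real q) * s)))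
                in F (L + B) - F (L - B)))"
proof -
  have first: "hsgp_imse P k S L m xs \<eta> t =
      (h \<bullet> ((W * G * W) *\<^sub>v h)) / ((power_function k xs \<eta> t)\<^sup>2 + \<eta>)"
    using hsgp_imse_quadratic_form[OF \<open>L > 0\<close> ordering] assms by simp
  have kron: "G = kronecker_power_ordered m c e (gram_mat_1 B L m)"
    using gram_mat_eq_kronecker_power_ordered[OF \<open>L > 0\<close> coordinates ordering] assms by simp
  have lex: "kronecker_power_ordered m c e (gram_mat_1 B L m) = kronecker_power (gram_mat_1 B L m) CARD('d)"
    if "\<forall>a<m ^ CARD('d). lex_position m c (e a) = a"
    using that by (intro kronecker_power_ordered_lex) (auto simp: gram_mat_1_def)
  have entry: "gram_mat_1 B L m $$ (p - 1, q - 1) =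
      (LINT x|lebesgue_on {-B..B}. sine_basis_1 L p x * sine_basis_1 L q x)"
    if "p \<in> {1..m}" "q \<in> {1..m}" for p q
    using that by (auto simp: gram_mat_1_def)
  show ?thesis
    using first kron lex entry integral_sine_basis_1_square[OF \<open>B > 0\<close> \<open>L > 0\<close>]
      integral_sine_basis_1_mult[OF \<open>B > 0\<close> \<open>L > 0\<close>]
    by (simp add: Let_def)
qed

end
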